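(* For every $\alpha, s \in \mathbb{N}$, there exists a Pfaffian function $f:\mathbb{R}\to\mathbb{R}$ of format $(\alpha,1,s)$ (with respect to some Pfaffian chain on $\mathbb{R}$) with at least $\alpha^{s}$ nondegenerate real zeros.
   Context: Notation: $\mathbb{N}$ denotes the positive integers, and $\mathbb{R}[Z_1,\dots,Z_r]_{(\le d)}$ denotes the real vector space of polynomials of total degree at most $d$ in $Z_1,\dots,Z_r$. Pfaffian chains. Let $\mathcal{U}\subseteq\mathbb{R}^n$ be open. A Pfaffian chain of order $s\in\mathbb{Z}_{\ge 0}$ and chain-degree $\alpha\in\mathbb{N}$ on $\mathcal{U}$ is a sequence of smooth functions $\vec{q}=(q_1,\dots,q_s)$ on $\mathcal{U}$ such that there exist polynomials $P_{i,j}\in\mathbb{R}[X_1,\dots,X_n,Y_1,\dots,Y_j]_{(\le\alpha)}$ with $$dq_j(\mathbf{x})=\sum_{i=1}^n P_{i,j}(\mathbf{x},q_1(\mathbf{x}),\dots,q_j(\mathbf{x}))\,dx_i\qquad (j=1,\dots,s).$$ Pfaffian functions. Let $\beta\in\mathbb{N}$. A function $f(\mathbf{x})=P(\mathbf{x},q_1(\mathbf{x}),\dots,q_s(\mathbf{x}))$ with $P\in\mathbb{R}[X_1,\dots,X_n,Y_1,\dots,Y_s]_{(\le\beta)}$, where $\vec q$ is a Pfaffian chain of order $s$ and chain-degree $\alpha$, is called a Pfaffian function with respect to $\vec{q}$ of format $(\alpha,\beta,s)$. A zero $\zeta$ of a smooth function $f:\mathbb{R}\to\mathbb{R}$ is nondegenerate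 if $f'(\zeta)\neq 0$. *)

theory Defs
  imports "HOL-Analysis.Analysis" "HOL-Library.Poly_Mapping"
begin

text \<open>
  Euclidean n-space is an arbitrary type \<open>'a\<close> of class \<open>euclidean_space\<close>, with \<open>n = DIM('a)\<close>;
  the coordinates \<open>X_1, ..., X_n\<close> are indexed by the standard basis \<open>Basis\<close>, and the
  coordinate of \<open>x\<close> at \<open>b\<close> is \<open>x \<bullet> b\<close>. The type \<open>real\<close> is the instance \<open>n = 1\<close>, with \<open>Basis = {1}\<close>.
\<close>

datatype 'a pvar = X 'a | Y nat

type_synonym 'v monomial = "'v \<Rightarrow>\<^sub>0 nat"
type_synonym 'v mpolynomial = "'v monomial \<Rightarrow>\<^sub>0 real"

definition monomial_eval :: "('v \<Rightarrow> real) \<Rightarrow> 'v monomial \<Rightarrow> real" where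
  "monomial_eval a m = (\<Prod>v\<in>Poly_Mapping.keys m. a v ^ Poly_Mapping.lookup m v)"

definition mpoly_eval :: "('v \<Rightarrow> real) \<Rightarrow> 'v mpolynomial \<Rightarrow> real" where
  "mpoly_eval a p = (\<Sum>m\<in>Poly_Mapping.keys p. Poly_Mapping.lookup p m * monomial_eval a m)"

definition monomial_degree :: "'v monomial \<Rightarrow> nat" where
  "monomial_degree m = (\<Sum>v\<in>Poly_Mapping.keys m. Poly_Mapping.lookup m v)"

definition polys_le :: "'v set \<Rightarrow> nat \<Rightarrow> 'v mpolynomial set" where
  "polys_le V d = {p. \<forall>m\<in>Poly_Mapping.keys p. Poly_Mapping.keys m \<subseteq> V \<and> monomial_degree m \<le> d}"

definition chain_vars :: "nat \<Rightarrow> 'a::euclidean_space pvar set" where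
  "chain_vars j = X ` Basis \<union> Y ` {1..j}"

definition chain_point :: "'a::euclidean_space \<Rightarrow> (nat \<Rightarrow> real) \<Rightarrow> 'a pvar \<Rightarrow> real" where
  "chain_point x y v = (case v of X b \<Rightarrow> x \<bullet> b | Y i \<Rightarrow> y i)"

text \<open>Meant for open \<open>U\<close>, where the derivative \<open>f'\<close> below is unique.\<close>

primrec Ck_on :: "nat \<Rightarrow> 'a::euclidean_space set \<Rightarrow> ('a \<Rightarrow> real) \<Rightarrow> bool" where
  "Ck_on 0 U f \<longleftrightarrow> continuous_on U f"
| "Ck_on (Suc k) U f \<longleftrightarrow>
     (\<exists>f'. (\<forall>x\<in>U. (f has_derivative f' x) (at x)) \<and> (\<forall>b\<in>Basis. Ck_on k U (\<lambda>x. f' x b)))"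

definition smooth_on :: "'a::euclidean_space set \<Rightarrow> ('a \<Rightarrow> real) \<Rightarrow> bool" where
  "smooth_on U f \<longleftrightarrow> (\<forall>k. Ck_on k U f)"

text \<open>
  The chain is \<open>q 1, ..., q s\<close>; other values of \<open>q\<close> are irrelevant. The linear form \<open>\<lambda>h. h \<bullet> b\<close>
  is the coordinate differential \<open>dx_b\<close>.
\<close>

definition pfaffian_chain ::
    "'a::euclidean_space set \<Rightarrow> nat \<Rightarrow> nat \<Rightarrow> (nat \<Rightarrow> 'a \<Rightarrow> real) \<Rightarrow> bool" where
  "pfaffian_chain U s \<alpha> q \<longleftrightarrow>
     open U \<and> (\<forall>j\<in>{1..s}. smooth_on U (q j)) \<and>
     (\<exists>P :: 'a \<Rightarrow> nat \<Rightarrow> 'a pvar mpolynomial.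
        (\<forall>b\<in>Basis. \<forall>j\<in>{1..s}. P b j \<in> polys_le (chain_vars j) \<alpha>) \<and>
        (\<forall>j\<in>{1..s}. \<forall>x\<in>U.
           (q j has_derivative
              (\<lambda>h. \<Sum>b\<in>Basis. mpoly_eval (chain_point x (\<lambda>i. q i x)) (P b j) * (h \<bullet> b))) (at x)))"

definition pfaffian_function_wrt ::
    "'a::euclidean_space set \<Rightarrow> (nat \<Rightarrow> 'a \<Rightarrow> real) \<Rightarrow> nat \<Rightarrow> nat \<Rightarrow> nat \<Rightarrow> ('a \<Rightarrow> real) \<Rightarrow> bool" where
  "pfaffian_function_wrt U q \<alpha> \<beta> s f \<longleftrightarrow>
     pfaffian_chain U s \<alpha> q \<and>
     (\<exists>P \<in> polys_le (chain_vars s) \<beta>. \<forall>x\<in>U. f x = mpoly_eval (chain_point x (\<lambda>i. q i x)) P)"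

definition nondegenerate_zero :: "(real \<Rightarrow> real) \<Rightarrow> real \<Rightarrow> bool" where
  "nondegenerate_zero f \<zeta> \<longleftrightarrow> f \<zeta> = 0 \<and> (\<exists>D. (f has_real_derivative D) (at \<zeta>) \<and> D \<noteq> 0)"

end

theory Submission
  imports Defs "HOL-Computational_Algebra.Polynomial"
begin

text \<open>
  Let \<open>T\<close> be the Chebyshev polynomial of degree \<open>\<alpha>\<close>, so that \<open>T (cos t) = cos (\<alpha> t)\<close>. Its
  \<open>s\<close>-fold iterate takes the value \<open>cos (\<alpha>^s t)\<close> at \<open>cos t\<close> and hence oscillates between \<open>1\<close> and
  \<open>-1\<close> exactly \<open>\<alpha>^s\<close> times on \<open>[-1,1]\<close>. The functions \<open>T (q)\<close> obtained by iterating are not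
  available as chain elements of low degree, because differentiating \<open>T (q)\<close> by the chain rule
  yields polynomials of degree above \<open>\<alpha>\<close>. They can however be approximated: a solution of the relaxation equation
  \<open>u' = K (h - u)\<close> stays within \<open>sup \<bar>h'\<bar> / K\<close> of \<open>h\<close> once it starts there, and its right-hand
  side involves \<open>h\<close> itself rather than \<open>h'\<close>. So put \<open>q\<^sub>0(x) = x\<close> and
  \<open>q\<^sub>j' = K\<^sub>j (T (q\<^sub>j\<^sub>-\<^sub>1) - q\<^sub>j)\<close>. This is a Pfaffian chain of chain-degree \<open>\<alpha>\<close>, and choosing the
  rates \<open>K\<^sub>1, K\<^sub>2, \<dots>\<close> successively large enough makes \<open>q\<^sub>s\<close> uniformly close on \<open>[-1,1]\<close> to the
  \<open>s\<close>-fold iterate of \<open>T\<close>.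

  Then \<open>q\<^sub>s\<close> crosses every level \<open>c\<close> with \<open>\<bar>c\<bar> < 1/2\<close> at least \<open>\<alpha>^s\<close> times. By Sard's theorem
  almost every such level is a regular value, which makes every zero of \<open>q\<^sub>s - c\<close> nondegenerate;
  and \<open>q\<^sub>s - c\<close> is a polynomial of degree one in the chain.
\<close>

section \<open>Evaluation of multivariate polynomials\<close>

lemma mpoly_eval_add: "mpoly_eval a (p + q) = mpoly_eval a p + mpoly_eval a q"
  unfolding mpoly_eval_def
  by (rule setsum_keys_plus_distrib[where f = "\<lambda>m c. c * monomial_eval a m"])
     (auto simp: algebra_simps)

lemma mpoly_eval_single: "mpoly_eval a (Poly_Mapping.single m c) = c * monomial_eval a m"
  by (simp add: mpoly_eval_def)

lemma mpoly_eval_sum: "mpoly_eval a (\<Sum>i\<in>I. p i) = (\<Sum>i\<in>I. mpoly_eval a (p i))"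
  by (induction I rule: infinite_finite_induct)
     (simp_all add: mpoly_eval_add, simp_all add: mpoly_eval_def)

lemma monomial_eval_single: "monomial_eval a (Poly_Mapping.single v k) = a v ^ k"
  by (simp add: monomial_eval_def)

lemma polys_le_add: "p \<in> polys_le V d \<Longrightarrow> q \<in> polys_le V d \<Longrightarrow> p + q \<in> polys_le V d"
  using keys_add[of p q] by (fastforce simp: polys_le_def)

lemma polys_le_sum: "(\<And>i. i \<in> I \<Longrightarrow> p i \<in> polys_le V d) \<Longrightarrow> (\<Sum>i\<in>I. p i) \<in> polys_le V d"
  by (induction I rule: infinite_finite_induct)
     (auto intro: polys_le_add, auto simp: polys_le_def)

lemma polys_le_single_power:
  "v \<in> V \<Longrightarrow> k \<le> d \<Longrightarrow> Poly_Mapping.single (Poly_Mapping.single v k) c \<in> polys_le V d"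
  by (auto simp: polys_le_def monomial_degree_def)

section \<open>Smoothness from an algebra closed under differentiation\<close>

inductive_set fun_algebra :: "(real \<Rightarrow> real) set \<Rightarrow> (real \<Rightarrow> real) set"
  for G where
  const: "(\<lambda>_. c) \<in> fun_algebra G"
| gen: "u \<in> G \<Longrightarrow> u \<in> fun_algebra G"
| add: "u \<in> fun_algebra G \<Longrightarrow> v \<in> fun_algebra G \<Longrightarrow> (\<lambda>x. u x + v x) \<in> fun_algebra G"
| mult: "u \<in> fun_algebra G \<Longrightarrow> v \<in> fun_algebra G \<Longrightarrow> (\<lambda>x. u x * v x) \<in> fun_algebra G"

lemma fun_algebra_poly:
  assumes "u \<in> fun_algebra G"
  shows "(\<lambda>x. poly p (u x)) \<in> fun_algebra G"
proof (induction p)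
  case 0
  show ?case using fun_algebra.const[of 0] by simp
next
  case (pCons a p)
  from fun_algebra.add[OF fun_algebra.const fun_algebra.mult[OF assms pCons.IH]]
  show ?case by simp
qed

lemma fun_algebra_diff:
  assumes "u \<in> fun_algebra G" "v \<in> fun_algebra G"
  shows "(\<lambda>x. u x - v x) \<in> fun_algebra G"
  using fun_algebra.add[OF assms(1) fun_algebra.mult[OF fun_algebra.const[of "-1"] assms(2)]]
  by simp

lemma fun_algebra_deriv:
  assumes G: "\<And>u. u \<in> G \<Longrightarrow> \<exists>u'\<in>fun_algebra G. \<forall>x. (u has_real_derivative u' x) (at x)"
    and "u \<in> fun_algebra G"
  shows "\<exists>u'\<in>fun_algebra G. \<forall>x. (u has_real_derivative u' x) (at x)"
  using assms(2)
proof induction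
  case (const c)
  show ?case by (rule bexI[OF _ fun_algebra.const[of 0]]) auto
next
  case (gen u)
  then show ?case by (rule G)
next
  case (add u v)
  then obtain u' v' where "u' \<in> fun_algebra G" "\<forall>x. (u has_real_derivative u' x) (at x)"
    "v' \<in> fun_algebra G" "\<forall>x. (v has_real_derivative v' x) (at x)" by blast
  then show ?case
    by (intro bexI[of _ "\<lambda>x. u' x + v' x"]) (auto intro: fun_algebra.intros DERIV_add)
next
  case (mult u v)
  then obtain u' v' where "u' \<in> fun_algebra G" "\<forall>x. (u has_real_derivative u' x) (at x)"
    "v' \<in> fun_algebra G" "\<forall>x. (v has_real_derivative v' x) (at x)" by blast
  with mult show ?case
    by (intro bexI[of _ "\<lambda>x. u' x * v x + v' x * u x"]) 
      (auto intro: fun_algebra.intros DERIV_mult)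
qed

text \<open>Closure under differentiation lets one descend any number of derivatives at once.\<close>

lemma smooth_on_if_closed_under_deriv:
  assumes A: "\<And>u. u \<in> A \<Longrightarrow> \<exists>u'\<in>A. \<forall>x. (u has_real_derivative u' x) (at x)"
    and "u \<in> A"
  shows "smooth_on UNIV u"
proof -
  have "Ck_on k UNIV u" if "u \<in> A" for k u
    using that
  proof (induction k arbitrary: u)
    case 0
    obtain u' where "\<forall>x. (u has_real_derivative u' x) (at x)" using A[OF 0] by blast
    then have "continuous_on UNIV u"
      by (meson DERIV_isCont continuous_at_imp_continuous_on)
    then show ?case by simp
  next
    case (Suc k)
    obtain u' where u': "u' \<in> A" "\<forall>x. (u has_real_derivative u' x) (at x)"
      using A[OF Suc.prems] by blast
    have "Ck_on k UNIV u'" using Suc.IH u'(1) .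
    with u'(2) show ?case
      by (auto simp: has_field_derivative_def intro!: exI[of _ "\<lambda>x h. u' x * h"])
  qed
  then show ?thesis using assms(2) by (simp add: smooth_on_def)
qed

section \<open>Chains of relaxation equations\<close>

text \<open>
  The independent variable is put in front of the chain as \<open>q 0\<close>, which makes all the equations
  uniform.
\<close>

definition tracking_chain ::
    "real poly \<Rightarrow> nat \<Rightarrow> (nat \<Rightarrow> real) \<Rightarrow> (nat \<Rightarrow> real \<Rightarrow> real) \<Rightarrow> bool" where
  "tracking_chain g s K q \<longleftrightarrow> q 0 = (\<lambda>x. x) \<and>
     (\<forall>j<s. \<forall>x. (q (Suc j) has_real_derivative K j * (poly g (q j x) - q (Suc j) x)) (at x))"

text \<open>
  The equations express each \<open>q\<^sub>j'\<close> polynomially in the \<open>q\<^sub>i\<close>, so the algebra they generate is closed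
  under differentiation. This yields both the smoothness of the chain and the continuity of the
  derivatives that the next relaxation equation depends on.
\<close>

lemma tracking_chain_algebra_deriv:
  assumes q: "tracking_chain g s K q" and "u \<in> fun_algebra (q ` {..s})"
  shows "\<exists>u'\<in>fun_algebra (q ` {..s}). \<forall>x. (u has_real_derivative u' x) (at x)"
proof (rule fun_algebra_deriv[OF _ assms(2)])
  fix u assume "u \<in> q ` {..s}"
  then obtain j where j: "j \<le> s" "u = q j" by auto
  show "\<exists>u'\<in>fun_algebra (q ` {..s}). \<forall>x. (u has_real_derivative u' x) (at x)"
  proof (cases j)
    case 0
    then show ?thesis using j q
      by (intro bexI[OF _ fun_algebra.const[of 1]]) (auto simp: tracking_chain_def)
  next
    case (Suc i)
    then have "q i \<in> fun_algebra (q ` {..s})" "q j \<in> fun_algebra (q ` {..s})"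
      using j by (auto intro: fun_algebra.gen)
    then have "(\<lambda>x. K i * (poly g (q i x) - q j x)) \<in> fun_algebra (q ` {..s})"
      by (intro fun_algebra.mult fun_algebra.const fun_algebra_diff fun_algebra_poly)
    moreover have "(q j has_real_derivative K i * (poly g (q i x) - q j x)) (at x)" for x
      using Suc j q by (auto simp: tracking_chain_def)
    ultimately show ?thesis
      using j(2) by (intro bexI[of _ "\<lambda>x. K i * (poly g (q i x) - q j x)"]) auto
  qed
qed

lemma pfaffian_chain_tracking_chain:
  assumes q: "tracking_chain g s K q" and deg: "degree g \<le> \<alpha>" "\<alpha> \<ge> 1"
  shows "pfaffian_chain UNIV s \<alpha> q"
proof -
  define var :: "nat \<Rightarrow> real pvar" where "var j = (if j = 0 then X 1 else Y j)" for j
  define P :: "nat \<Rightarrow> real pvar mpolynomial" where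
    "P j = (\<Sum>k\<le>degree g. Poly_Mapping.single (Poly_Mapping.single (var (j - 1)) k)
              (K (j - 1) * coeff g k))
           + Poly_Mapping.single (Poly_Mapping.single (Y j) 1) (- K (j - 1))" for j
  have point: "chain_point x (\<lambda>i. q i x) (var j) = q j x" for x j
    using q by (simp add: var_def chain_point_def tracking_chain_def)
  have eval: "mpoly_eval (chain_point x (\<lambda>i. q i x)) (P j)
      = K (j - 1) * (poly g (q (j - 1) x) - q j x)" for x j
  proof -
    have "chain_point x (\<lambda>i. q i x) (Y j) = q j x" by (simp add: chain_point_def)
    then show ?thesis
      unfolding P_def
      by (simp add: mpoly_eval_add mpoly_eval_sum mpoly_eval_single monomial_eval_single point
          poly_altdef sum_distrib_left algebra_simps)
  qed
  have "P j \<in> polys_le (chain_vars j) \<alpha>" if "j \<in> {1..s}" for j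
  proof -
    have "var (j - 1) \<in> chain_vars j" "Y j \<in> (chain_vars j :: real pvar set)"
      using that by (auto simp: var_def chain_vars_def)
    then show ?thesis unfolding P_def
      using deg by (intro polys_le_add polys_le_sum polys_le_single_power) auto
  qed
  moreover have "(q j has_derivative
      (\<lambda>h. \<Sum>b\<in>Basis. mpoly_eval (chain_point x (\<lambda>i. q i x)) (P j) * (h \<bullet> b))) (at x)"
    if "j \<in> {1..s}" for j x
  proof -
    have "j = Suc (j - 1)" "j - 1 < s" using that by auto
    then obtain i where "j = Suc i" "i < s" by blast
    then show ?thesis using q
      by (auto simp: eval tracking_chain_def has_field_derivative_def)
  qed
  moreover have "smooth_on UNIV (q j)" if "j \<in> {1..s}" for j
    using that tracking_chain_algebra_deriv[OF q]
    by (intro smooth_on_if_closed_under_deriv[of "fun_algebra (q ` {..s})"])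
      (auto intro: fun_algebra.gen)
  ultimately show ?thesis
    unfolding pfaffian_chain_def by (auto intro!: exI[of _ "\<lambda>_. P"])
qed

text \<open>
  Let \<open>M\<close> bound \<open>\<bar>h'\<bar>\<close>. For the solution with \<open>u = h\<close> at the left end, the functions
  \<open>exp (K x) (M/K \<plusminus> (u - h))\<close> have the derivatives \<open>exp (K x) (M \<mp> h') \<ge> 0\<close> and are therefore
  nonnegative; so \<open>\<bar>u - h\<bar> \<le> M/K\<close>, and \<open>K = 2 M / \<epsilon>\<close> makes this \<open>\<epsilon>/2\<close>.
\<close>

lemma relaxation_tracks:
  fixes h h' :: "real \<Rightarrow> real" and a b :: real
  assumes h: "\<And>x. (h has_real_derivative h' x) (at x)" and cont: "continuous_on UNIV h'"
    and "\<epsilon> > 0"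
  obtains K u where "\<And>x. (u has_real_derivative K * (h x - u x)) (at x)"
    and "\<And>x. a \<le> x \<Longrightarrow> x \<le> b \<Longrightarrow> \<bar>u x - h x\<bar> < \<epsilon>"
proof -
  have "compact (h' ` {a..b})"
    using cont by (meson compact_Icc compact_continuous_image continuous_on_subset top_greatest)
  then obtain M where M: "\<And>x. x \<in> {a..b} \<Longrightarrow> \<bar>h' x\<bar> \<le> M"
    by (metis compact_imp_bounded bounded_iff image_eqI real_norm_def)
  define K where "K = 2 * M / \<epsilon>"
  have K: "K * (\<epsilon> / 2) = M" using \<open>\<epsilon> > 0\<close> by (simp add: K_def)
  have hc: "isCont h x" for x using h DERIV_isCont by blast
  obtain F where "\<forall>x::real. -\<infinity> < ereal x \<longrightarrow> ereal x < \<infinity> \<longrightarrow>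
      (F has_vector_derivative K * exp (K * x) * h x) (at x)"
    using einterval_antiderivative[of "-\<infinity>" "\<infinity>" "\<lambda>x. K * exp (K * x) * h x"] hc
    by (force intro!: continuous_intros)
  then have F: "(F has_real_derivative K * exp (K * x) * h x) (at x)" for x
    by (simp add: has_real_derivative_iff_has_vector_derivative)
  define u where "u x = exp (- (K * x)) * (F x - F a + exp (K * a) * h a)" for x
  have u: "(u has_real_derivative K * (h x - u x)) (at x)" for x
  proof -
    have "(u has_real_derivative
        - K * exp (- (K * x)) * (F x - F a + exp (K * a) * h a)
        + (K * exp (K * x) * h x) * exp (- (K * x))) (at x)"
      unfolding u_def by (auto intro!: derivative_eq_intros F)
    moreover have "- K * exp (- (K * x)) * (F x - F a + exp (K * a) * h a)
        + (K * exp (K * x) * h x) * exp (- (K * x)) = K * (h x - u x)"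
    proof -
      have "(K * exp (K * x) * h x) * exp (- (K * x)) = K * h x * (exp (K * x) * exp (- (K * x)))"
        by (simp only: ac_simps)
      also have "\<dots> = K * h x" by (simp flip: exp_add)
      finally show ?thesis by (simp only: u_def) (simp add: right_diff_distrib mult.assoc)
    qed
    ultimately show ?thesis by (simp only:)
  qed
  have ua: "u a = h a" by (simp add: u_def flip: exp_add mult.assoc)
  have bound: "\<sigma> * (u x - h x) \<ge> - (\<epsilon> / 2)" if x: "a \<le> x" "x \<le> b" and \<sigma>: "\<bar>\<sigma>\<bar> = 1" for x \<sigma>
  proof -
    define \<phi> where "\<phi> y = exp (K * y) * (\<sigma> * (u y - h y) + \<epsilon> / 2)" for y
    have \<phi>: "(\<phi> has_real_derivative exp (K * y) * (M - \<sigma> * h' y)) (at y)" for y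
    proof -
      have "(\<phi> has_real_derivative K * exp (K * y) * (\<sigma> * (u y - h y) + \<epsilon> / 2)
          + \<sigma> * (K * (h y - u y) - h' y) * exp (K * y)) (at y)"
        unfolding \<phi>_def by (auto intro!: derivative_eq_intros u h)
      moreover have "K * exp (K * y) * (\<sigma> * (u y - h y) + \<epsilon> / 2)
          + \<sigma> * (K * (h y - u y) - h' y) * exp (K * y) = exp (K * y) * (M - \<sigma> * h' y)"
        unfolding K[symmetric] by (simp only: algebra_simps)
      ultimately show ?thesis by (simp only:)
    qed
    have nonneg: "exp (K * y) * (M - \<sigma> * h' y) \<ge> 0" if "a \<le> y" "y \<le> x" for y
    proof -
      have "\<bar>\<sigma> * h' y\<bar> \<le> M" using M[of y] that x \<sigma> by (simp add: abs_mult)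
      then show ?thesis by (simp add: abs_le_iff)
    qed
    have "\<phi> a \<le> \<phi> x"
      using \<phi> nonneg by (intro DERIV_nonneg_imp_nondecreasing[OF x(1)]) blast
    moreover have "\<phi> a \<ge> 0" using ua \<open>\<epsilon> > 0\<close> by (simp add: \<phi>_def)
    ultimately have "0 \<le> exp (K * x) * (\<sigma> * (u x - h x) + \<epsilon> / 2)" by (simp only: \<phi>_def)
    then have "0 \<le> \<sigma> * (u x - h x) + \<epsilon> / 2" by (simp only: zero_le_mult_iff) auto
    then show ?thesis by linarith
  qed
  show thesis
  proof (rule that[OF u])
    show "\<bar>u x - h x\<bar> < \<epsilon>" if "a \<le> x" "x \<le> b" for x
      using bound[OF that, of 1] bound[OF that, of "-1"] \<open>\<epsilon> > 0\<close> by simp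
  qed
qed

section \<open>Approximating iterated Chebyshev polynomials\<close>

fun chebyshev :: "nat \<Rightarrow> real poly" where
  "chebyshev 0 = 1"
| "chebyshev (Suc 0) = [:0, 1:]"
| "chebyshev (Suc (Suc n)) = [:0, 2:] * chebyshev (Suc n) - chebyshev n"

lemma degree_chebyshev: "degree (chebyshev n) \<le> n"
proof (induction n rule: chebyshev.induct)
  case (3 n)
  have "degree ([:0, 2:] * chebyshev (Suc n)) \<le> Suc (Suc n)"
    using degree_mult_le[of "[:0, 2:]" "chebyshev (Suc n)"] 3 by simp
  with 3 show ?case by (auto intro!: degree_diff_le)
qed auto

lemma poly_chebyshev_cos: "poly (chebyshev n) (cos t) = cos (real n * t)"
proof (induction n rule: chebyshev.induct)
  case (3 n)
  have "cos (real (Suc (Suc n)) * t) + cos (real n * t) = 2 * cos t * cos (real (Suc n) * t)"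
    using cos_plus_cos[of "real (Suc (Suc n)) * t" "real n * t"]
    by (simp add: algebra_simps add_divide_distrib)
  with 3 show ?case by simp
qed auto

text \<open>
  Uniform continuity of the Chebyshev polynomial carries an approximation of one iterate over to
  the next one, and a fast relaxation equation realises the result as the next chain element.
\<close>

lemma tracking_chain_approximates_cos:
  fixes \<epsilon> :: real
  assumes "\<epsilon> > 0"
  shows "\<exists>K q. tracking_chain (chebyshev \<alpha>) s K q \<and>
           (\<forall>t. \<bar>q s (cos t) - cos (real (\<alpha> ^ s) * t)\<bar> < \<epsilon>)"
  using assms
proof (induction s arbitrary: \<epsilon>)
  case 0
  then show ?case by (intro exI[of _ "\<lambda>_. 0"] exI[of _ "\<lambda>_ x. x"]) (auto simp: tracking_chain_def)
next
  case (Suc s)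
  let ?T = "poly (chebyshev \<alpha>)"
  have "uniformly_continuous_on {-2..2} ?T"
    by (intro compact_uniformly_continuous continuous_intros) auto
  then obtain \<delta> where "\<delta> > 0"
    and \<delta>: "\<And>x y. x \<in> {-2..2} \<Longrightarrow> y \<in> {-2..2} \<Longrightarrow> \<bar>y - x\<bar> < \<delta> \<Longrightarrow> \<bar>?T y - ?T x\<bar> < \<epsilon> / 2"
    using \<open>\<epsilon> > 0\<close> unfolding uniformly_continuous_on_def dist_real_def
    by (metis half_gt_zero)
  \<comment> \<open>The bound \<open>1\<close> keeps \<open>q s\<close> inside \<open>[-2,2]\<close>, where \<open>\<delta>\<close> applies.\<close>
  have "min \<delta> 1 > 0" using \<open>\<delta> > 0\<close> by simp
  from Suc.IH[OF this] obtain K q where q: "tracking_chain (chebyshev \<alpha>) s K q"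
    and near: "\<And>t. \<bar>q s (cos t) - cos (real (\<alpha> ^ s) * t)\<bar> < min \<delta> 1" by blast
  define h where "h x = ?T (q s x)" for x
  note alg_deriv = tracking_chain_algebra_deriv[OF q]
  have "h \<in> fun_algebra (q ` {..s})"
    unfolding h_def[abs_def] by (intro fun_algebra_poly fun_algebra.gen) auto
  from alg_deriv[OF this] obtain h' where h': "h' \<in> fun_algebra (q ` {..s})"
    "\<And>x. (h has_real_derivative h' x) (at x)" by blast
  from alg_deriv[OF h'(1)] have "continuous_on UNIV h'"
    by (meson DERIV_isCont continuous_at_imp_continuous_on)
  with h'(2) \<open>\<epsilon> > 0\<close> obtain L u
    where u: "\<And>x. (u has_real_derivative L * (h x - u x)) (at x)"
      and close: "\<And>x. -1 \<le> x \<Longrightarrow> x \<le> 1 \<Longrightarrow> \<bar>u x - h x\<bar> < \<epsilon> / 2"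
    using relaxation_tracks[of h h' "\<epsilon> / 2" "-1" 1] by (metis half_gt_zero)
  have "tracking_chain (chebyshev \<alpha>) (Suc s) (K(s := L)) (q(Suc s := u))"
    using q u by (auto simp: tracking_chain_def h_def less_Suc_eq)
  moreover have "\<bar>(q(Suc s := u)) (Suc s) (cos t) - cos (real (\<alpha> ^ Suc s) * t)\<bar> < \<epsilon>" for t
  proof -
    let ?c = "cos (real (\<alpha> ^ s) * t)"
    have "\<bar>?c\<bar> \<le> 1" by (rule abs_cos_le_one)
    moreover have "\<bar>q s (cos t) - ?c\<bar> < \<delta>" "\<bar>q s (cos t) - ?c\<bar> < 1" using near[of t] by auto
    ultimately have "?c \<in> {-2..2}" "q s (cos t) \<in> {-2..2}"
      unfolding atLeastAtMost_iff by linarith+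
    then have "\<bar>h (cos t) - ?T ?c\<bar> < \<epsilon> / 2"
      unfolding h_def using \<open>\<bar>q s (cos t) - ?c\<bar> < \<delta>\<close> by (rule \<delta>)
    moreover have "?T ?c = cos (real (\<alpha> ^ Suc s) * t)"
      by (simp add: poly_chebyshev_cos mult.assoc)
    moreover have "\<bar>u (cos t) - h (cos t)\<bar> < \<epsilon> / 2" by (rule close) auto
    ultimately show ?thesis unfolding fun_upd_same by linarith
  qed
  ultimately show ?case by blast
qed

section \<open>Regular values and crossings\<close>

text \<open>
  By Sard's theorem, applied through \<open>real^1 \<cong> real\<close>, the critical values form a negligible set,
  which cannot contain an open interval.
\<close>

lemma ex_regular_value:
  fixes f f' :: "real \<Rightarrow> real"
  assumes der: "\<And>x. (f has_real_derivative f' x) (at x)" and "a < b"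
  obtains c where "a < c" "c < b" "\<And>x. f x = c \<Longrightarrow> f' x \<noteq> 0"
proof -
  define S where "S = {x. f' x = 0}"
  let ?F = "\<lambda>x::real^1. vec (f (x $ 1)) :: real^1"
  have "negligible (?F ` (vec ` S))"
  proof (rule baby_Sard)
    fix x :: "real^1" assume "x \<in> vec ` S"
    then obtain y where y: "x = vec y" "f' y = 0" by (auto simp: S_def)
    have "(f has_derivative (\<lambda>x. x * f' y)) (at y within S)"
      using der[of y]
      by (simp add: has_field_derivative_def mult_commute_abs has_derivative_at_withinI)
    note has_derivative_vector_1[where g = f and g' = f' and a = y and S = S, OF this]
    moreover have "(*\<^sub>R) (0::real) = (\<lambda>_. 0::real^1)" by auto
    ultimately show "(?F has_derivative (\<lambda>_. 0)) (at x within vec ` S)" using y by simp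
    have "matrix (\<lambda>_::real^1. 0::real^1) = 0" by (simp add: matrix_def vec_eq_iff)
    then show "rank (matrix (\<lambda>_::real^1. 0::real^1)) < CARD(1)" by simp
  qed simp
  moreover have "\<not> negligible (box (vec a) (vec b :: real^1))"
    using \<open>a < b\<close> by (intro open_not_negligible open_box) (auto simp: box_ne_empty Basis_vec_def inner_axis)
  ultimately have "\<not> box (vec a) (vec b) \<subseteq> ?F ` (vec ` S)"
    using negligible_subset by blast
  then obtain v :: "real^1" where v: "v \<in> box (vec a) (vec b)" "v \<notin> ?F ` (vec ` S)" by blast
  show thesis
  proof
    show "a < v $ 1" "v $ 1 < b" using v(1) by (auto simp: mem_box_cart)
    show "f' x \<noteq> 0" if "f x = v $ 1" for x
    proof
      assume "f' x = 0"
      then have "v = ?F (vec x)" "x \<in> S" using that by (auto simp: S_def vec_eq_iff)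
      then show False using v(2) by blast
    qed
  qed
qed

lemma ex_zeros_between_sign_changes:
  fixes f x :: "_ \<Rightarrow> real"
  assumes cont: "continuous_on UNIV f"
    and dec: "\<And>i. i < N \<Longrightarrow> x (Suc i) < x i"
    and alt: "\<And>i. i \<le> N \<Longrightarrow> (-1) ^ i * f (x i) > 0"
  shows "\<exists>Z. finite Z \<and> card Z = N \<and> (\<forall>z\<in>Z. f z = 0)"
proof -
  have "\<exists>z. x (Suc i) < z \<and> z < x i \<and> f z = 0" if i: "i < N" for i
  proof -
    let ?g = "\<lambda>y. (-1) ^ i * f y"
    have ends: "?g (x (Suc i)) < 0" "?g (x i) > 0" using alt[of i] alt[of "Suc i"] i by auto
    have "continuous_on {x (Suc i)..x i} ?g"
      using cont by (intro continuous_intros) (auto intro: continuous_on_subset)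
    with ends dec[OF i] obtain z where "x (Suc i) \<le> z" "z \<le> x i" "?g z = 0"
      using IVT'[of ?g "x (Suc i)" 0 "x i"] by auto
    with ends have "z \<noteq> x i" "z \<noteq> x (Suc i)" "f z = 0" by auto
    with \<open>x (Suc i) \<le> z\<close> \<open>z \<le> x i\<close> show ?thesis by force
  qed
  then obtain z where z: "\<And>i. i < N \<Longrightarrow> x (Suc i) < z i \<and> z i < x i \<and> f (z i) = 0" by metis
  have anti: "x j \<le> x i" if "i \<le> j" "j \<le> N" for i j
    using that
  proof (induction rule: dec_induct)
    case (step n)
    then show ?case using dec[of n] by simp
  qed simp
  have less: "z j < z i" if "i < j" "j < N" for i j
    using z[of i] z[of j] anti[of "Suc i" j] that by force
  have "inj_on z {..<N}"
  proof (rule inj_onI)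
    fix i j assume "i \<in> {..<N}" "j \<in> {..<N}" "z i = z j"
    then show "i = j" using less[of i j] less[of j i] by (cases i j rule: linorder_cases) auto
  qed
  then show ?thesis using z by (intro exI[of _ "z ` {..<N}"]) (auto simp: card_image)
qed

section \<open>A Pfaffian function of degree one with many zeros\<close>

theorem theorem1p2:
  fixes \<alpha> s :: nat
  assumes "\<alpha> \<ge> 1" and "s \<ge> 1"
  shows "\<exists>(q :: nat \<Rightarrow> real \<Rightarrow> real) (f :: real \<Rightarrow> real).
           pfaffian_function_wrt UNIV q \<alpha> 1 s f \<and>
           (\<exists>Z. finite Z \<and> card Z \<ge> \<alpha> ^ s \<and> (\<forall>\<zeta>\<in>Z. nondegenerate_zero f \<zeta>))"
proof -
  define N where "N = \<alpha> ^ s"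
  have N: "N > 0" using assms by (simp add: N_def)
  obtain K q where q: "tracking_chain (chebyshev \<alpha>) s K q"
    and near: "\<And>t. \<bar>q s (cos t) - cos (real N * t)\<bar> < 1/2"
    using tracking_chain_approximates_cos[of "1/2" \<alpha> s] unfolding N_def by auto
  have "q s \<in> fun_algebra (q ` {..s})" by (auto intro: fun_algebra.gen)
  from tracking_chain_algebra_deriv[OF q this] obtain D
    where D: "\<And>x. (q s has_real_derivative D x) (at x)" by blast
  obtain c where c: "-(1/2) < c" "c < 1/2" "\<And>x. q s x = c \<Longrightarrow> D x \<noteq> 0"
    using ex_regular_value[OF D, of "-(1/2)" "1/2"] by auto
  define f where "f x = q s x - c" for x
  have fD: "(f has_real_derivative D x) (at x)" for x
    unfolding f_def[abs_def] by (auto intro!: derivative_eq_intros D)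
  have "\<exists>Z. finite Z \<and> card Z = N \<and> (\<forall>z\<in>Z. f z = 0)"
  proof (rule ex_zeros_between_sign_changes)
    show "continuous_on UNIV f" by (meson fD DERIV_isCont continuous_at_imp_continuous_on)
    \<comment> \<open>The points where the iterated Chebyshev polynomial attains \<open>\<plusminus>1\<close>.\<close>
    let ?t = "\<lambda>i. real i * pi / real N"
    show "cos (?t (Suc i)) < cos (?t i)" if "i < N" for i
    proof -
      have "real (Suc i) * pi \<le> real N * pi" using that by (intro mult_right_mono) auto
      with N show ?thesis by (intro cos_monotone_0_pi) (auto simp: field_simps)
    qed
    show "(-1) ^ i * f (cos (?t i)) > 0" if "i \<le> N" for i
    proof -
      have "cos (real N * ?t i) = (-1) ^ i" using N by (simp add: cos_npi)
      then have "\<bar>q s (cos (?t i)) - (-1) ^ i\<bar> < 1/2" using near[of "?t i"] by (simp only:)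
      then have "(-1) ^ i - 1/2 < q s (cos (?t i))" "q s (cos (?t i)) < (-1) ^ i + 1/2"
        unfolding abs_less_iff by linarith+
      with c(1,2) show ?thesis
        by (cases "even i") (simp_all add: f_def)
    qed
  qed
  then obtain Z where Z: "finite Z" "card Z = N" "\<forall>z\<in>Z. f z = 0" by blast
  have nondegenerate: "\<forall>z\<in>Z. nondegenerate_zero f z"
  proof
    fix z assume "z \<in> Z"
    then show "nondegenerate_zero f z"
      unfolding nondegenerate_zero_def using Z(3) fD[of z] c(3)[of z] by (auto simp: f_def)
  qed
  have pfaffian: "pfaffian_function_wrt UNIV q \<alpha> 1 s f"
  proof -
    \<comment> \<open>The constant term is written as a multiple of the zeroth power of the variable.\<close>
    let ?P = "Poly_Mapping.single (Poly_Mapping.single (Y s) 1) 1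
        + Poly_Mapping.single (Poly_Mapping.single (X 1) 0) (- c) :: real pvar mpolynomial"
    have "?P \<in> polys_le (chain_vars s) 1"
      using assms by (intro polys_le_add polys_le_single_power) (auto simp: chain_vars_def)
    moreover have "f x = mpoly_eval (chain_point x (\<lambda>i. q i x)) ?P" for x
      by (simp only: mpoly_eval_add mpoly_eval_single monomial_eval_single)
        (simp add: f_def chain_point_def)
    ultimately show ?thesis
      unfolding pfaffian_function_wrt_def
      using pfaffian_chain_tracking_chain[OF q degree_chebyshev assms(1)] by blast
  qed
  have "card Z \<ge> \<alpha> ^ s" using Z(2) by (simp add: N_def)
  with pfaffian nondegenerate Z(1) show ?thesis by blast
qed

end
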